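(* Let $d\colon(\mathbb{R}^2)^3\to\mathbb{R}$ be the $3$-distance on $\mathbb{R}^2$ that carries $(x_1,x_2,x_3)$ into the length of the Euclidean Steiner tree constructed on the points $x_1,x_2,x_3$, that is, $$d(x_1,x_2,x_3)=\min_{x\in\mathbb{R}^2}\sum_{i=1}^3|x_i-x|.$$ Then its best constant is $K^*_3=\frac{1}{2}$, and this value is attained.
   Context: $|\cdot|$ is the Euclidean norm and $\mathbb{R}_+=[0,+\infty[$. For a set $X$ with at least two elements, a $3$-distance on $X$ is a map $d\colon X^3\to\mathbb{R}_+$ such that: (i) $d(x_1,x_2,x_3)=0$ if and only if $x_1=x_2=x_3$; (ii) $d$ is invariant under any permutation of its arguments; (iii) $d(x_1,x_2,x_3)\leq\sum_{i=1}^3 d(x_1,x_2,x_3)_i^z$ for all $x_1,x_2,x_3,z\in X$, where $d(x_1,x_2,x_3)_i^z$ denotes the value obtained from $d(x_1,x_2,x_3)$ by replacing its $i$th argument by $z$. The best constant associated with a $3$-distance $d$ on $X$ is $$K^*_3=\sup\left\{\frac{d(x_1,x_2,x_3)}{\sum_{i=1}^3 d(x_1,x_2,x_3)_i^z}: x_1,x_2,x_3,z\in X,\ |\{x_1,x_2,x_3\}|\geq 2\right\}.$$ It is attained if the ratio equals $K^*_3$ for some $x_1,x_2,x_3,z\in X$ with $|\{x_1,x_2,x_3\}|\geq 2$. The Euclidean Steiner tree constructed on given points is the shortest network (in the Euclidean sense) connecting the points, where auxiliary points (Steiner points) may be added in order to minimize the total length. *)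

theory Defs
  imports "HOL-Analysis.Analysis"
begin

definition three_distance :: "'a set \<Rightarrow> ('a \<Rightarrow> 'a \<Rightarrow> 'a \<Rightarrow> real) \<Rightarrow> bool" where
  "three_distance X d \<longleftrightarrow>
     (\<exists>x\<in>X. \<exists>y\<in>X. x \<noteq> y) \<and>
     (\<forall>x1\<in>X. \<forall>x2\<in>X. \<forall>x3\<in>X. d x1 x2 x3 \<ge> 0) \<and>
     (\<forall>x1\<in>X. \<forall>x2\<in>X. \<forall>x3\<in>X. d x1 x2 x3 = 0 \<longleftrightarrow> x1 = x2 \<and> x2 = x3) \<and>
     (\<forall>x1\<in>X. \<forall>x2\<in>X. \<forall>x3\<in>X.
        d x1 x3 x2 = d x1 x2 x3 \<and> d x2 x1 x3 = d x1 x2 x3 \<and> d x2 x3 x1 = d x1 x2 x3 \<and>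
        d x3 x1 x2 = d x1 x2 x3 \<and> d x3 x2 x1 = d x1 x2 x3) \<and>
     (\<forall>x1\<in>X. \<forall>x2\<in>X. \<forall>x3\<in>X. \<forall>z\<in>X.
        d x1 x2 x3 \<le> d z x2 x3 + d x1 z x3 + d x1 x2 z)"

definition simplex_ratio :: "('a \<Rightarrow> 'a \<Rightarrow> 'a \<Rightarrow> real) \<Rightarrow> 'a \<Rightarrow> 'a \<Rightarrow> 'a \<Rightarrow> 'a \<Rightarrow> real" where
  "simplex_ratio d x1 x2 x3 z = d x1 x2 x3 / (d z x2 x3 + d x1 z x3 + d x1 x2 z)"

text \<open>
  The real supremum is the genuine one whenever \<open>d\<close> is a 3-distance on \<open>X\<close>: then the set below
  is nonempty, its denominators are positive and its elements are at most 1.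
\<close>

definition best_constant :: "'a set \<Rightarrow> ('a \<Rightarrow> 'a \<Rightarrow> 'a \<Rightarrow> real) \<Rightarrow> real" where
  "best_constant X d =
     Sup {simplex_ratio d x1 x2 x3 z | x1 x2 x3 z.
            x1 \<in> X \<and> x2 \<in> X \<and> x3 \<in> X \<and> z \<in> X \<and> card {x1, x2, x3} \<ge> 2}"

definition best_constant_attained :: "'a set \<Rightarrow> ('a \<Rightarrow> 'a \<Rightarrow> 'a \<Rightarrow> real) \<Rightarrow> bool" where
  "best_constant_attained X d \<longleftrightarrow>
     (\<exists>x1\<in>X. \<exists>x2\<in>X. \<exists>x3\<in>X. \<exists>z\<in>X.
        card {x1, x2, x3} \<ge> 2 \<and> simplex_ratio d x1 x2 x3 z = best_constant X d)"

text \<open>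
  A network is a finite graph in the plane with straight edges, given by the set of its edges;
  a pair \<open>(u, v)\<close> is the undirected edge joining \<open>u\<close> and \<open>v\<close>, in either orientation. Vertices
  other than the points to be connected are the auxiliary (Steiner) points. A shortest network has
  no superfluous edge, hence is automatically a tree.
\<close>

definition connecting_network :: "(real^2) set \<Rightarrow> ((real^2) \<times> (real^2)) set \<Rightarrow> bool" where
  "connecting_network P E \<longleftrightarrow>
     finite E \<and> (\<forall>(u, v)\<in>E. u \<noteq> v) \<and> (\<forall>p\<in>P. \<forall>q\<in>P. (p, q) \<in> (E \<union> E\<inverse>)\<^sup>*)"

definition network_length :: "((real^2) \<times> (real^2)) set \<Rightarrow> real" where
  "network_length E = (\<Sum>(u, v)\<in>E. norm (u - v))"

definition steiner_tree :: "(real^2) set \<Rightarrow> ((real^2) \<times> (real^2)) set \<Rightarrow> bool" where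
  "steiner_tree P E \<longleftrightarrow>
     connecting_network P E \<and>
     (\<forall>E'. connecting_network P E' \<longrightarrow> network_length E \<le> network_length E')"

definition star_length :: "real^2 \<Rightarrow> real^2 \<Rightarrow> real^2 \<Rightarrow> real^2 \<Rightarrow> real" where
  "star_length x1 x2 x3 x = norm (x1 - x) + norm (x2 - x) + norm (x3 - x)"

text \<open>
  Defined as an infimum; that it is a minimum is a separate claim.
\<close>

definition steiner_dist :: "real^2 \<Rightarrow> real^2 \<Rightarrow> real^2 \<Rightarrow> real" where
  "steiner_dist x1 x2 x3 = (INF x. star_length x1 x2 x3 x)"

end

theory Submission imports Defs begin

text \<open>
  The bound \<open>K \<le> 1/2\<close> is convex duality. The length of the shortest star on \<open>x\<^sub>1, x\<^sub>2, x\<^sub>3\<close> is the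
  maximum of \<open>\<Sum>\<^sub>i u\<^sub>i \<bullet> x\<^sub>i\<close> over all \<open>u\<^sub>1, u\<^sub>2, u\<^sub>3\<close> in the unit ball with \<open>u\<^sub>1 + u\<^sub>2 + u\<^sub>3 = 0\<close>: every such
  triple bounds every star from below, since \<open>\<Sum>\<^sub>i u\<^sub>i \<bullet> x\<^sub>i = \<Sum>\<^sub>i u\<^sub>i \<bullet> (x\<^sub>i - x) \<le> \<Sum>\<^sub>i \<bar>x\<^sub>i - x\<bar>\<close>, and
  if the minimiser \<open>x\<close> is none of the \<open>x\<^sub>i\<close>, the unit vectors pointing from \<open>x\<close> to the \<open>x\<^sub>i\<close> give
  equality (\<open>approximate_dual_certificate\<close> treats all positions of \<open>x\<close> together). The triple
  that is optimal for \<open>x\<^sub>1, x\<^sub>2, x\<^sub>3\<close> may also be used as a bound for the three triples in which some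
  \<open>x\<^sub>i\<close> is replaced by \<open>z\<close>. Adding the three bounds, each \<open>u\<^sub>j \<bullet> x\<^sub>j\<close> occurs twice, and the terms with
  \<open>z\<close> add up to \<open>(u\<^sub>1 + u\<^sub>2 + u\<^sub>3) \<bullet> z = 0\<close>; so the three distances add up to at least
  \<open>2 d(x\<^sub>1, x\<^sub>2, x\<^sub>3)\<close> (\<open>steiner_dist_double_le\<close>). Equality holds for \<open>x\<^sub>1 = x\<^sub>2 = z \<noteq> x\<^sub>3\<close>.

  That shortest networks have the length of shortest stars is a statement about graphs
  (\<open>network_contains_star\<close>): a path from \<open>x\<^sub>1\<close> to \<open>x\<^sub>2\<close> and a path from \<open>x\<^sub>3\<close> that stops as soon as it
  meets the former one have no common edge, and by the triangle inequality their total length is at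
  least that of the star centred at their meeting point.
\<close>

section \<open>Minimal stars and their dual certificates\<close>

lemma continuous_coercive_attains_min:
  fixes f :: "'a::euclidean_space \<Rightarrow> real"
  assumes cont: "continuous_on UNIV f" and coercive: "\<And>x. norm (a - x) \<le> f x"
  shows "\<exists>x. \<forall>y. f x \<le> f y"
proof -
  have "\<exists>x\<in>cball a (f a). \<forall>y\<in>cball a (f a). f x \<le> f y"
    using coercive[of a] by (intro continuous_attains_inf continuous_on_subset[OF cont]) auto
  then obtain x where x: "\<And>y. y \<in> cball a (f a) \<Longrightarrow> f x \<le> f y" by blast
  have "f x \<le> f y" for y
  proof (cases "y \<in> cball a (f a)")
    case False
    have "f x \<le> f a" using x[of a] coercive[of a] by simp
    also have "f a \<le> f y" using False coercive[of y] by (simp add: dist_norm)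
    finally show ?thesis .
  qed (rule x)
  then show ?thesis by blast
qed

lemma smoothed_norm_has_derivative:
  fixes a x :: "'a::euclidean_space"
  assumes "e > 0"
  shows "((\<lambda>x. sqrt ((a - x) \<bullet> (a - x) + e\<^sup>2)) has_derivative
          (\<lambda>h. - (((a - x) /\<^sub>R sqrt ((a - x) \<bullet> (a - x) + e\<^sup>2)) \<bullet> h))) (at x)"
proof -
  have pos: "(a - x) \<bullet> (a - x) + e\<^sup>2 > 0" using assms by (simp add: add_nonneg_pos)
  have "((\<lambda>x. (a - x) \<bullet> (a - x) + e\<^sup>2) has_derivative (\<lambda>h. - (2 * ((a - x) \<bullet> h)))) (at x)"
    by (rule has_derivative_eq_rhs, (rule derivative_intros)+) (simp add: inner_commute)
  from has_derivative_real_sqrt[OF pos this] show ?thesis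
    by (simp add: mult.commute)
qed

lemma smoothed_unit_vector:
  fixes v :: "'a::euclidean_space"
  assumes "e > 0"
  defines "u \<equiv> v /\<^sub>R sqrt (v \<bullet> v + e\<^sup>2)"
  shows "norm u \<le> 1" and "norm v - e \<le> u \<bullet> v"
proof -
  define s where "s = sqrt ((norm v)\<^sup>2 + e\<^sup>2)"
  have u: "u = v /\<^sub>R s" by (simp add: u_def s_def power2_norm_eq_inner)
  have s: "s > 0" "norm v \<le> s" "s \<le> norm v + e"
    using assms sqrt_sum_squares_le_sum[of "norm v" e]
    by (auto simp: s_def add_nonneg_pos real_le_rsqrt)
  have s2: "s\<^sup>2 = (norm v)\<^sup>2 + e\<^sup>2" by (simp add: s_def)
  show "norm u \<le> 1" using s by (simp add: u field_simps)
  have "(norm v - e) * s \<le> (norm v)\<^sup>2"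
  proof (cases "norm v \<le> e")
    case True
    then have "(norm v - e) * s \<le> 0" using s by (simp add: mult_nonpos_nonneg)
    then show ?thesis by (meson order_trans zero_le_power2)
  next
    case False
    then have "(norm v - e) * s \<le> (norm v - e) * (norm v + e)"
      using s by (intro mult_left_mono) auto
    also have "\<dots> \<le> (norm v)\<^sup>2" by (simp add: algebra_simps power2_eq_square)
    finally show ?thesis .
  qed
  then show "norm v - e \<le> u \<bullet> v"
    using s by (simp add: u field_simps power2_norm_eq_inner)
qed

text \<open>
  At a minimiser of \<open>\<Sum>\<^sub>i \<bar>x\<^sub>i - x\<bar>\<close> that is none of the \<open>x\<^sub>i\<close>, the unit vectors towards the \<open>x\<^sub>i\<close> add
  up to zero. Smoothing each summand to \<open>sqrt (\<bar>x\<^sub>i - x\<bar>\<^sup>2 + e\<^sup>2)\<close> extends this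
  argument to minimisers at one of the \<open>x\<^sub>i\<close>, where the norm is not differentiable. The price is that
  the certificate is only optimal up to \<open>3e\<close>.
\<close>
lemma approximate_dual_certificate:
  fixes a b c :: "'a::euclidean_space"
  assumes "e > 0"
  shows "\<exists>u v w x. norm u \<le> 1 \<and> norm v \<le> 1 \<and> norm w \<le> 1 \<and> u + v + w = 0 \<and>
           norm (a - x) + norm (b - x) + norm (c - x) - 3 * e \<le> u \<bullet> a + v \<bullet> b + w \<bullet> c"
proof -
  define g where "g = (\<lambda>p x :: 'a. sqrt ((p - x) \<bullet> (p - x) + e\<^sup>2))"
  define f where "f = (\<lambda>x. g a x + g b x + g c x)"
  have g_ge: "norm (p - x) \<le> g p x" for p x
    by (simp add: g_def norm_eq_sqrt_inner)
  have g_nonneg: "0 \<le> g p x" for p x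
    by (simp add: g_def)
  have "continuous_on UNIV f"
    unfolding f_def g_def by (intro continuous_intros)
  moreover have "norm (a - x) \<le> f x" for x
    using g_ge[where p = a and x = x] g_nonneg[of b x] g_nonneg[of c x] by (simp add: f_def)
  ultimately obtain x where x: "\<And>y. f x \<le> f y"
    using continuous_coercive_attains_min by blast
  define u where "u = (\<lambda>p. (p - x) /\<^sub>R sqrt ((p - x) \<bullet> (p - x) + e\<^sup>2))"
  have "(f has_derivative (\<lambda>h. - (u a \<bullet> h) + - (u b \<bullet> h) + - (u c \<bullet> h))) (at x)"
    unfolding f_def g_def u_def
    by (intro has_derivative_add smoothed_norm_has_derivative assms)
  then have "(\<lambda>h. - (u a \<bullet> h) + - (u b \<bullet> h) + - (u c \<bullet> h)) = (\<lambda>h. 0)"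
    by (intro differential_zero_maxmin[of x UNIV f]) (use x in auto)
  then have "(u a + u b + u c) \<bullet> h = 0" for h
    by (drule_tac fun_cong[of _ _ h]) (simp add: inner_add_left)
  then have zero: "u a + u b + u c = 0"
    by (metis inner_eq_zero_iff)
  then have zero_x: "(u a + u b + u c) \<bullet> x = 0" by simp
  have unit: "norm (u p) \<le> 1" and near: "norm (p - x) - e \<le> u p \<bullet> (p - x)" for p
    using smoothed_unit_vector[OF assms, of "p - x"] by (simp_all add: u_def)
  have "norm (a - x) + norm (b - x) + norm (c - x) - 3 * e
      \<le> u a \<bullet> a + u b \<bullet> b + u c \<bullet> c"
    using zero_x near[of a] near[of b] near[of c] by (simp add: inner_add_left inner_diff_right)
  with zero unit show ?thesis by blast
qed

lemma star_length_nonneg: "0 \<le> star_length a b c x"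
  by (simp add: star_length_def)

lemma steiner_dist_le: "steiner_dist a b c \<le> star_length a b c x"
  unfolding steiner_dist_def
  by (rule cINF_lower) (auto intro!: bdd_belowI[of _ 0] simp: star_length_nonneg)

lemma steiner_dist_attained: "\<exists>x. steiner_dist a b c = star_length a b c x"
proof -
  have "continuous_on UNIV (star_length a b c)"
    unfolding star_length_def by (intro continuous_intros)
  moreover have "norm (a - x) \<le> star_length a b c x" for x
    by (simp add: star_length_def)
  ultimately obtain x where x: "\<And>y. star_length a b c x \<le> star_length a b c y"
    using continuous_coercive_attains_min by blast
  have "star_length a b c x \<le> steiner_dist a b c"
    unfolding steiner_dist_def by (rule cINF_greatest) (auto simp: x)
  then show ?thesis
    using steiner_dist_le[of a b c x] by (auto intro!: exI[of _ x])
qed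

lemma dual_bound:
  assumes "norm u \<le> 1" "norm v \<le> 1" "norm w \<le> 1" "u + v + w = 0"
  shows "u \<bullet> a + v \<bullet> b + w \<bullet> c \<le> steiner_dist a b c"
proof -
  obtain x where x: "steiner_dist a b c = star_length a b c x"
    using steiner_dist_attained by blast
  have le: "t \<bullet> y \<le> norm y" if "norm t \<le> 1" for t y :: "real^2"
    using norm_cauchy_schwarz[of t y] mult_right_mono[OF that norm_ge_zero[of y]] by simp
  have "(u + v + w) \<bullet> x = 0" using assms by simp
  then show ?thesis
    using le[OF assms(1), of "a - x"] le[OF assms(2), of "b - x"] le[OF assms(3), of "c - x"]
    by (simp add: x star_length_def inner_add_left inner_diff_right)
qed

section \<open>The simplex inequality with constant one half\<close>

text \<open>
  One certificate for \<open>a, b, c\<close> serves all three triples on the right, because a dual bound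
  restricts only \<open>u, v, w\<close> and not the points.
\<close>
lemma steiner_dist_double_le:
  "2 * steiner_dist a b c \<le> steiner_dist z b c + steiner_dist a z c + steiner_dist a b z"
proof (rule field_le_epsilon)
  fix e :: real
  assume "e > 0"
  \<comment> \<open>The certificate loses three times its parameter, and the loss is doubled on the left.\<close>
  then have "e / 6 > 0" by simp
  from approximate_dual_certificate[OF this, of a b c]
  obtain u v w x where uvw: "norm u \<le> 1" "norm v \<le> 1" "norm w \<le> 1" "u + v + w = 0"
    and x: "norm (a - x) + norm (b - x) + norm (c - x) - 3 * (e / 6) \<le> u \<bullet> a + v \<bullet> b + w \<bullet> c"
    by blast
  have "(u + v + w) \<bullet> z = 0" using uvw by simp
  then show "2 * steiner_dist a b c
      \<le> steiner_dist z b c + steiner_dist a z c + steiner_dist a b z + e"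
    using dual_bound[OF uvw, of z b c] dual_bound[OF uvw, of a z c] dual_bound[OF uvw, of a b z]
      x steiner_dist_le[of a b c x]
    by (simp add: star_length_def inner_add_left)
qed

lemma steiner_dist_nonneg: "0 \<le> steiner_dist a b c"
  using steiner_dist_attained[of a b c] star_length_nonneg by auto

lemma steiner_dist_eq_0_iff: "steiner_dist a b c = 0 \<longleftrightarrow> a = b \<and> b = c"
proof
  assume "steiner_dist a b c = 0"
  then obtain x where "norm (a - x) + norm (b - x) + norm (c - x) = 0"
    using steiner_dist_attained[of a b c] by (auto simp: star_length_def)
  then show "a = b \<and> b = c"
    by (auto simp: add_nonneg_eq_0_iff)
next
  assume "a = b \<and> b = c"
  then show "steiner_dist a b c = 0"
    using steiner_dist_le[of a a a a] steiner_dist_nonneg[of a a a] by (simp add: star_length_def)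
qed

lemma steiner_dist_swap:
  "steiner_dist a c b = steiner_dist a b c" "steiner_dist b a c = steiner_dist a b c"
  by (simp_all add: steiner_dist_def star_length_def algebra_simps)

lemma three_distance_steiner_dist: "three_distance UNIV steiner_dist"
proof -
  have "\<exists>x y :: real^2. x \<noteq> y"
    using zero_neq_one by blast
  moreover have "steiner_dist a b c \<le> steiner_dist z b c + steiner_dist a z c + steiner_dist a b z"
    for a b c z
    using steiner_dist_double_le[of a b c z] steiner_dist_nonneg[of a b c] by linarith
  ultimately show ?thesis
    unfolding three_distance_def
    by (auto simp: steiner_dist_nonneg steiner_dist_eq_0_iff) (metis steiner_dist_swap)+
qed

lemma simplex_ratio_le_half:
  assumes "card {a, b, c} \<ge> 2"
  shows "simplex_ratio steiner_dist a b c z \<le> 1 / 2"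
proof -
  have "steiner_dist a b c \<noteq> 0"
    using assms by (auto simp: steiner_dist_eq_0_iff)
  then have "steiner_dist a b c > 0"
    using steiner_dist_nonneg[of a b c] by simp
  then show ?thesis
    using steiner_dist_double_le[of a b c z]
    by (simp add: simplex_ratio_def divide_le_eq)
qed

lemma simplex_ratio_degenerate:
  assumes "a \<noteq> b"
  shows "simplex_ratio steiner_dist a a b a = 1 / 2"
proof -
  have "steiner_dist a a b \<noteq> 0" "steiner_dist a a a = 0"
    using assms by (simp_all add: steiner_dist_eq_0_iff)
  then show ?thesis by (simp add: simplex_ratio_def)
qed

lemma best_constant_steiner_dist:
  "best_constant UNIV steiner_dist = 1 / 2" "best_constant_attained UNIV steiner_dist"
proof -
  obtain a b :: "real^2" where ab: "a \<noteq> b"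
    using zero_neq_one by blast
  then have card: "card {a, a, b} \<ge> 2" by simp
  show eq: "best_constant UNIV steiner_dist = 1 / 2"
    unfolding best_constant_def
  proof (rule cSup_eq_maximum)
    show "1 / 2 \<in> {simplex_ratio steiner_dist x1 x2 x3 z | x1 x2 x3 z.
        x1 \<in> UNIV \<and> x2 \<in> UNIV \<and> x3 \<in> UNIV \<and> z \<in> UNIV \<and> card {x1, x2, x3} \<ge> 2}"
      using simplex_ratio_degenerate[OF ab] card by (metis (mono_tags, lifting) UNIV_I mem_Collect_eq)
  qed (auto dest: simplex_ratio_le_half)
  show "best_constant_attained UNIV steiner_dist"
    unfolding best_constant_attained_def eq
    using simplex_ratio_degenerate[OF ab] card by blast
qed

section \<open>Shortest networks\<close>

lemma network_length_mono:
  "finite E \<Longrightarrow> F \<subseteq> E \<Longrightarrow> network_length F \<le> network_length E"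
  unfolding network_length_def by (rule sum_mono2) auto

lemma network_length_Un:
  "finite E \<Longrightarrow> finite F \<Longrightarrow> E \<inter> F = {} \<Longrightarrow>
    network_length (E \<union> F) = network_length E + network_length F"
  unfolding network_length_def by (rule sum.union_disjoint)

lemma rtrancl_enters_set:
  assumes "(x, a) \<in> R\<^sup>*" "x \<notin> A" "a \<in> A"
  shows "\<exists>u v. (u, v) \<in> R \<and> u \<notin> A \<and> v \<in> A"
  using assms by (induction rule: rtrancl_induct) blast+

text \<open>
  \<open>G\<close> and \<open>V\<close> are the edges and vertices of a path from \<open>x\<close> that stops when it first meets \<open>A\<close>.
  The path is found backwards: a path to \<open>A\<close> enlarged by a neighbour \<open>u\<close> of \<open>A\<close> is extended by one
  edge if it ends at \<open>u\<close>. That edge lies inside the enlarged set and hence does not occur in the path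
  already found, so that the edges are distinct and their lengths add up.
\<close>
lemma path_to_set:
  assumes "finite E" "a \<in> A" "(x, a) \<in> (E \<union> E\<inverse>)\<^sup>*"
  shows "\<exists>w\<in>A. \<exists>V G. G \<subseteq> E \<and> w \<in> V \<and> G \<subseteq> V \<times> V \<and> G \<inter> A \<times> A = {} \<and>
           (\<forall>v\<in>V. norm (x - v) + norm (v - w) \<le> network_length G)"
  using assms(2,3)
proof (induction "card ((fst ` E \<union> snd ` E) - A)" arbitrary: A a rule: less_induct)
  case less
  show ?case
  proof (cases "x \<in> A")
    case True
    then show ?thesis
      by (intro bexI[of _ x] exI[of _ "{x}"] exI[of _ "{}"]) (auto simp: network_length_def)
  next
    case False
    then obtain u v where uv: "(u, v) \<in> E \<union> E\<inverse>" "u \<notin> A" "v \<in> A"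
      using rtrancl_enters_set[OF less.prems(2) False less.prems(1)] by blast
    have "u \<in> fst ` E \<union> snd ` E"
      using uv(1) by force
    then have fewer: "card ((fst ` E \<union> snd ` E) - insert u A) < card ((fst ` E \<union> snd ` E) - A)"
      using uv(2) \<open>finite E\<close> by (intro psubset_card_mono) auto
    obtain w V G where w: "w \<in> insert u A" "G \<subseteq> E" "w \<in> V" "G \<subseteq> V \<times> V"
      "G \<inter> insert u A \<times> insert u A = {}"
      and len: "\<forall>t\<in>V. norm (x - t) + norm (t - w) \<le> network_length G"
      using less.hyps[OF fewer insertI2[OF less.prems(1)] less.prems(2)] by blast
    show ?thesis
    proof (cases "w \<in> A")
      case True
      then show ?thesis
        using w len by (intro bexI[of _ w] exI[of _ V] exI[of _ G]) auto
    next
      case False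
      then have wu: "w = u" using w(1) by simp
      obtain g where g: "g \<in> E" "g = (u, v) \<or> g = (v, u)"
        using uv(1) by blast
      have "finite G" using w(2) \<open>finite E\<close> finite_subset by blast
      moreover have "g \<notin> G" using w(5) g(2) uv(3) by auto
      ultimately have "network_length (insert g G) = norm (u - v) + network_length G"
        using g(2) by (auto simp: network_length_def norm_minus_commute)
      moreover have "norm (x - t) + norm (t - v) \<le> norm (u - v) + network_length G"
        if "t \<in> insert v V" for t
      proof (cases "t \<in> V")
        case True
        then show ?thesis
          using bspec[OF len True] norm_triangle_ineq[of "t - u" "u - v"] wu by simp
      next
        case False
        then have "t = v" using that by simp
        then show ?thesis
          using bspec[OF len w(3)] norm_triangle_ineq[of "x - u" "u - v"] wu by simp
      qed
      moreover have "insert g G \<subseteq> insert v V \<times> insert v V" "insert g G \<inter> A \<times> A = {}"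
        using g(2) w(3,4,5) wu uv(2) by auto
      ultimately show ?thesis
        using uv(3) g(1) w(2)
        by (intro bexI[of _ v] exI[of _ "insert v V"] exI[of _ "insert g G"]) auto
    qed
  qed
qed

lemma network_contains_star:
  assumes "connecting_network {a, b, c} E"
  shows "\<exists>w. star_length a b c w \<le> network_length E"
proof -
  have E: "finite E" and conn: "(a, b) \<in> (E \<union> E\<inverse>)\<^sup>*" "(c, b) \<in> (E \<union> E\<inverse>)\<^sup>*"
    using assms by (auto simp: connecting_network_def)
  from path_to_set[OF E _ conn(1), of "{b}"]
  obtain V G where G: "G \<subseteq> E" "b \<in> V" "G \<subseteq> V \<times> V"
    and ab: "\<And>v. v \<in> V \<Longrightarrow> norm (a - v) + norm (v - b) \<le> network_length G"
    by auto
  from path_to_set[OF E \<open>b \<in> V\<close> conn(2)]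
  obtain w W H where w: "w \<in> V" and H: "H \<subseteq> E" "H \<inter> V \<times> V = {}"
    and cw: "w \<in> W" "\<forall>v\<in>W. norm (c - v) + norm (v - w) \<le> network_length H"
    by auto
  have "star_length a b c w \<le> network_length G + network_length H"
    using ab[OF w] bspec[OF cw(2,1)] by (simp add: star_length_def norm_minus_commute)
  also have "\<dots> = network_length (G \<union> H)"
    using G H E by (intro network_length_Un[symmetric]) (auto intro: finite_subset)
  also have "\<dots> \<le> network_length E"
    using G(1) H(1) by (intro network_length_mono E) auto
  finally show ?thesis by blast
qed

text \<open>
  Only an inequality holds for the length: when points coincide, the edges of the star do so too and
  are counted once.
\<close>
lemma star_network:
  "\<exists>E. connecting_network {a, b, c} E \<and> network_length E \<le> star_length a b c x"
proof -
  define E where "E = (\<lambda>p. (p, x)) ` ({a, b, c} - {x})"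
  have to_x: "(p, x) \<in> (E \<union> E\<inverse>)\<^sup>*" and from_x: "(x, p) \<in> (E \<union> E\<inverse>)\<^sup>*"
    if "p \<in> {a, b, c}" for p
    using that by (cases "p = x"; force simp: E_def intro: r_into_rtrancl)+
  have "connecting_network {a, b, c} E"
    unfolding connecting_network_def
  proof (intro conjI ballI)
    fix p q assume "p \<in> {a, b, c}" "q \<in> {a, b, c}"
    then show "(p, q) \<in> (E \<union> E\<inverse>)\<^sup>*"
      using to_x from_x rtrancl_trans by meson
  qed (auto simp: E_def)
  moreover have "network_length E = (\<Sum>p\<in>{a, b, c} - {x}. norm (p - x))"
    by (simp add: network_length_def E_def sum.reindex inj_on_def)
  moreover have "\<dots> \<le> (\<Sum>p\<in>{a, b, c}. norm (p - x))"
    by (rule sum_mono2) auto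
  moreover have "\<dots> \<le> star_length a b c x"
    by (auto simp: star_length_def sum.insert_if)
  ultimately show ?thesis by fastforce
qed

lemma steiner_dist_le_network_length:
  "connecting_network {a, b, c} E \<Longrightarrow> steiner_dist a b c \<le> network_length E"
  using network_contains_star steiner_dist_le order_trans by blast

lemma network_of_length_steiner_dist:
  "\<exists>E. connecting_network {a, b, c} E \<and> network_length E = steiner_dist a b c"
  by (metis steiner_dist_attained star_network steiner_dist_le_network_length order_antisym)

lemma steiner_tree_exists: "\<exists>T. steiner_tree {a, b, c} T"
  unfolding steiner_tree_def
  by (metis network_of_length_steiner_dist steiner_dist_le_network_length)

lemma steiner_tree_length:
  "steiner_tree {a, b, c} T \<Longrightarrow> network_length T = steiner_dist a b c"
  unfolding steiner_tree_def
  by (metis network_of_length_steiner_dist steiner_dist_le_network_length order_antisym)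

section \<open>The best constant of the Steiner distance\<close>

theorem proposition5p2:
  "(\<forall>x1 x2 x3. (\<exists>x. steiner_dist x1 x2 x3 = star_length x1 x2 x3 x) \<and>
                (\<forall>x. steiner_dist x1 x2 x3 \<le> star_length x1 x2 x3 x)) \<and>
   (\<forall>x1 x2 x3. (\<exists>T. steiner_tree {x1, x2, x3} T) \<and>
                (\<forall>T. steiner_tree {x1, x2, x3} T \<longrightarrow> network_length T = steiner_dist x1 x2 x3)) \<and>
   three_distance UNIV steiner_dist \<and>
   best_constant UNIV steiner_dist = 1 / 2 \<and>
   best_constant_attained UNIV steiner_dist"
  by (intro conjI allI impI steiner_dist_attained steiner_dist_le steiner_tree_exists
      steiner_tree_length three_distance_steiner_dist best_constant_steiner_dist)

end
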